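(* Let $q=3^d$ with $d\geq 1$, let $b\in\mathbb{F}_q$, and consider the elliptic curve $E\colon y^2=x^3-x+b$ over $\mathbb{F}_q$. For $d$ odd, \[\#E(\mathbb{F}_q)=\begin{cases} q+1 & \text{if } \operatorname{Tr}(b)=0,\\ q+1+(-1)^{\frac{d-1}{2}}\sqrt{3q} & \text{if } \operatorname{Tr}(b)=1,\\ q+1-(-1)^{\frac{d-1}{2}}\sqrt{3q} & \text{if } \operatorname{Tr}(b)=-1. \end{cases}\] For $d$ even, \[\#E(\mathbb{F}_q)=\begin{cases} q+1-(-1)^{\frac d2}\,2\sqrt q & \text{if } \operatorname{Tr}(b)=0,\\ q+1+(-1)^{\frac d2}\sqrt q & \text{if } \operatorname{Tr}(b)=\pm1. \end{cases}\]
   Context: $\operatorname{Tr}$ denotes the trace map $\mathbb{F}_q\to\mathbb{F}_3$, with $\mathbb{F}_3=\{0,1,-1\}$. $\#E(\mathbb{F}_q)$ counts all $\mathbb{F}_q$-rational points, including the point at infinity. *)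

theory Defs
  imports Complex_Main "HOL-Library.Cardinality" "HOL-Number_Theory.Number_Theory"
begin

(* The rational points of y^2 = x^3 + a*x + b: the affine solutions and one point at infinity. *)
datatype 'a point = Infinity | Affine 'a 'a

definition curve_points :: "'a :: field \<Rightarrow> 'a \<Rightarrow> 'a point set" where
  "curve_points a b = insert Infinity {Affine x y | x y. y ^ 2 = x ^ 3 + a * x + b}"

definition curve_disc :: "'a :: field \<Rightarrow> 'a \<Rightarrow> 'a" where
  "curve_disc a b = - 16 * (4 * a ^ 3 + 27 * b ^ 2)"

(* The trace of the extension of degree d of F_3, i.e. the sum of the conjugates
   x, x^3, ..., x^(3^(d-1)) of x. The base field F_3 is the subset {0, 1, -1} of the type,
   see trace_F3_in_prime_field. *)
definition trace_F3 :: "nat \<Rightarrow> 'a :: field \<Rightarrow> 'a" where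
  "trace_F3 d x = (\<Sum>i<d. x ^ (3 ^ i))"

lemma CHAR_eq_3:
  assumes "CARD('a :: finite_field) = 3 ^ d"
  shows "CHAR('a) = 3"
proof -
  have "CHAR('a) dvd 3 ^ d"
    using CHAR_dvd_CARD[where 'a = 'a] assms by simp
  moreover have "prime (CHAR('a))"
    by (simp add: prime_CHAR_semidom)
  ultimately have "CHAR('a) dvd 3"
    using prime_dvd_power by blast
  thus ?thesis
    using \<open>prime (CHAR('a))\<close> by (intro primes_dvd_imp_eq) auto
qed

(* The curves y^2 = x^3 - x + b in characteristic 3 are nonsingular for every b. *)
lemma curve_disc_nonzero:
  fixes b :: "'a :: finite_field"
  assumes "CARD('a) = 3 ^ d"
  shows "curve_disc (-1) b \<noteq> 0"
proof -
  have "of_nat n = (0 :: 'a) \<longleftrightarrow> 3 dvd n" for n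
    using CHAR_eq_3[OF assms] by (simp add: of_nat_eq_0_iff_char_dvd)
  from this[of 27] this[of 64] show ?thesis
    by (simp add: curve_disc_def)
qed

lemma trace_F3_in_prime_field:
  fixes x :: "'a :: finite_field"
  assumes "CARD('a) = 3 ^ d"
  shows "trace_F3 d x \<in> {0, 1, -1}"
proof -
  define t where "t = trace_F3 d x"
  have x: "x ^ (3 ^ d) = x"
    using finite_field_power_card_eq_same[of x] assms by simp
  have "t ^ 3 = (\<Sum>i<d. (x ^ (3 ^ i)) ^ 3)"
    unfolding t_def trace_F3_def
    by (rule freshmans_dream_sum) (simp_all add: CHAR_eq_3[OF assms])
  also have "\<dots> = (\<Sum>i<d. x ^ (3 ^ Suc i))"
    by (simp add: power_mult [symmetric] mult.commute)
  also have "\<dots> = t"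
    using sum.lessThan_Suc_shift[of "\<lambda>i. x ^ (3 ^ i)" d] x
    by (simp add: t_def trace_F3_def)
  finally have "t * (t - 1) * (t + 1) = 0"
    by (simp add: algebra_simps power3_eq_cube)
  thus ?thesis
    by (auto simp: t_def add_eq_0_iff2)
qed

end

(* The map x |-> x^3 - x on F_q has image ker Tr and all its nonempty fibres have 3 elements,
   so #E = 1 + 3 N_c, where N_c is the number of y with Tr(y^2) = c, and c = Tr(b).
   Since x^2 - y^2 = (x - y)(x + y), the sum of the N_c^2 is the number of (u, v) with Tr(uv) = 0.
   Together with N_0 + N_1 + N_{-1} = q and the symmetry s |-> -s, which preserves squares exactly
   if d is even, this determines the N_c up to one sign. The sign comes from N_1 mod 4:
   by Vieta the product of all x with Tr(x) = 1 is 1, so an even number of them are nonsquares.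
   As there are 3^(d-1) of them, an odd number are squares, and N_1 is twice that number. *)
theory Submission
  imports Defs "HOL-Computational_Algebra.Polynomial"
begin

section \<open>Counting by fibres, and powers modulo 4\<close>

lemma card_eq_mult_card_image:
  assumes "finite A" and "\<And>y. y \<in> f ` A \<Longrightarrow> card {x \<in> A. f x = y} = k"
  shows "card A = k * card (f ` A)"
proof -
  have "card A = (\<Sum>y\<in>f ` A. card {x \<in> A. f x = y})"
    using sum.image_gen[OF assms(1), of "\<lambda>_. 1::nat" f] by simp
  thus ?thesis
    using assms(2) by (simp add: mult.commute)
qed

lemma minus_one_power_eq_one_iff:
  assumes "(-1 :: 'a :: ring_1) \<noteq> 1"
  shows "(-1 :: 'a) ^ n = 1 \<longleftrightarrow> even n"
  using assms by (auto simp: minus_one_power_iff)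

lemma three_power_mod_4: "3 ^ n mod 4 = (if even n then 1 else 3 :: nat)"
proof -
  have "(9::nat) ^ k mod 4 = 1" for k
    using power_mod[of "9::nat" 4 k] by simp
  moreover from this have "3 * 9 ^ k mod 4 = (3::nat)" for k
    using mod_mult_right_eq[of "3::nat" "9 ^ k" 4] by simp
  ultimately show ?thesis
    by (auto elim!: evenE oddE simp: power_mult)
qed

text \<open>The square determines \<open>t\<close> up to sign. As -3 is 1 modulo 4, so is
  \<open>(- 3) ^ k\<close>, while its negative is 3 modulo 4; the residue therefore picks the
  sign.\<close>

lemma eq_minus_three_power:
  fixes t :: int
  assumes "t\<^sup>2 = 9 ^ k" and "t mod 4 = 1"
  shows "t = (- 3) ^ k"
proof -
  have "((- 3) ^ k)\<^sup>2 = (9 :: int) ^ k"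
    by (simp flip: power_mult_distrib add: power2_eq_square)
  moreover have "(- 3) ^ k mod 4 = (1 :: int)"
    using power_mod[of "-3 :: int" 4 k] by simp
  moreover from calculation(1) have "t = (- 3) ^ k \<or> t = - ((- 3) ^ k)"
    using assms(1) by (metis power2_eq_iff)
  ultimately show ?thesis
    using assms(2) by presburger
qed

section \<open>Characteristic 3 and additivity of the trace\<close>

context
  fixes d :: nat
  assumes card_UNIV: "CARD('a :: finite_field) = 3 ^ d"
begin

lemma three_eq_zero: "(3 :: 'a) = 0"
  using CHAR_eq_3[OF card_UNIV] of_nat_CHAR[where 'a = 'a] by simp

lemma two_eq: "(2 :: 'a) = -1"
  using three_eq_zero by (metis add_eq_0_iff2 numeral_3_eq_3 numeral_plus_one one_add_one semiring_norm(5))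

lemma minus_one_neq_one: "(-1 :: 'a) \<noteq> 1"
  using two_eq by (metis one_add_one add_cancel_right_left one_neq_zero)

lemma degree_pos: "d > 0"
proof (rule ccontr)
  assume "\<not> d > 0"
  hence "card (UNIV :: 'a set) \<le> 1"
    using card_UNIV by simp
  moreover have "card {0, 1 :: 'a} \<le> card (UNIV :: 'a set)"
    by (intro card_mono) auto
  ultimately show False by simp
qed

lemma card_UNIV': "CARD('a) = 3 * 3 ^ (d - 1)"
  using card_UNIV degree_pos by (simp add: power_eq_if)

lemma cube_add: "(x + y :: 'a) ^ 3 = x ^ 3 + y ^ 3"
  by (rule freshmans_dream) (simp_all add: CHAR_eq_3[OF card_UNIV])

lemma trace_add: "trace_F3 d (x + y :: 'a) = trace_F3 d x + trace_F3 d y"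
proof -
  have "(x + y) ^ 3 ^ i = x ^ 3 ^ i + y ^ 3 ^ i" for i
    by (rule freshmans_dream') (simp_all add: CHAR_eq_3[OF card_UNIV])
  thus ?thesis
    by (simp add: trace_F3_def sum.distrib)
qed

lemma trace_zero: "trace_F3 d (0 :: 'a) = 0"
  by (simp add: trace_F3_def power_0_left)

lemma trace_minus: "trace_F3 d (- x :: 'a) = - trace_F3 d x"
  using trace_add[of x "-x"] trace_zero by (simp add: add_eq_0_iff)

lemma trace_diff: "trace_F3 d (x - y :: 'a) = trace_F3 d x - trace_F3 d y"
  using trace_add[of x "-y"] trace_minus by simp

text \<open>Cubing shifts the conjugates cyclically, since x^q = x. Hence x^3 - x always has trace
  0.\<close>

lemma trace_cube: "trace_F3 d (x ^ 3 :: 'a) = trace_F3 d x"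
proof -
  have "trace_F3 d (x ^ 3) = (\<Sum>i<d. x ^ (3 ^ Suc i))"
    by (simp add: trace_F3_def power_mult [symmetric])
  also have "\<dots> = trace_F3 d x"
    using sum.lessThan_Suc_shift[of "\<lambda>i. x ^ (3 ^ i)" d] finite_field_power_card_eq_same[of x] card_UNIV
    by (simp add: trace_F3_def)
  finally show ?thesis .
qed

section \<open>The trace as a polynomial and the size of its fibres\<close>

definition trace_poly :: "'a \<Rightarrow> 'a poly" where
  "trace_poly c = (\<Sum>i<d. monom 1 (3 ^ i)) - [:c:]"

lemma poly_trace_poly: "poly (trace_poly c) x = trace_F3 d x - c"
  by (simp add: trace_poly_def trace_F3_def poly_sum poly_monom)

lemma degree_trace_poly: "degree (trace_poly c) = 3 ^ (d - 1)"
  and lead_coeff_trace_poly: "lead_coeff (trace_poly c) = 1"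
proof -
  \<comment> \<open>The summand with index \<open>d - 1\<close>, present because
    \<open>d > 0\<close>, is split off; everything left in \<open>q\<close> has smaller
    degree.\<close>
  define q where "q = (\<Sum>i<d-1. monom (1::'a) (3 ^ i)) - [:c:]"
  have eq: "trace_poly c = monom 1 (3 ^ (d - 1)) + q"
    using sum.lessThan_Suc[of "\<lambda>i. monom (1::'a) (3 ^ i)" "d - 1"] degree_pos
    by (simp add: trace_poly_def q_def)
  have "degree q < 3 ^ (d - 1)"
    unfolding q_def
    by (intro degree_diff_less degree_sum_less)
       (auto intro: le_less_trans[OF degree_monom_le])
  thus deg: "degree (trace_poly c) = 3 ^ (d - 1)"
    by (simp add: eq degree_add_eq_left degree_monom_eq)
  show "lead_coeff (trace_poly c) = 1"
    unfolding deg using \<open>degree q < 3 ^ (d - 1)\<close> by (simp add: eq coeff_eq_0)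
qed

text \<open>Each fibre is the root set of a polynomial of degree 3^(d-1), which bounds its size. The
  three fibres cover all 3 * 3^(d-1) elements, so every bound is attained.\<close>

lemma card_trace_eq:
  assumes "c \<in> {0, 1, -1}"
  shows "card {x :: 'a. trace_F3 d x = c} = 3 ^ (d - 1)"
proof -
  have le: "card {x :: 'a. trace_F3 d x = c} \<le> 3 ^ (d - 1)" for c
  proof -
    have "trace_poly c \<noteq> 0"
      using lead_coeff_trace_poly[of c] by auto
    from card_poly_roots_bound[OF this] show ?thesis
      by (simp add: poly_trace_poly degree_trace_poly)
  qed
  have "UNIV = {x :: 'a. trace_F3 d x = 0} \<union> {x. trace_F3 d x = 1} \<union> {x. trace_F3 d x = -1}"
    using trace_F3_in_prime_field[OF card_UNIV] by auto
  also have "card \<dots> = card {x :: 'a. trace_F3 d x = 0} + card {x :: 'a. trace_F3 d x = 1}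
      + card {x :: 'a. trace_F3 d x = -1}"
    by (subst card_Un_disjoint; (subst card_Un_disjoint)?) (use minus_one_neq_one in auto)
  finally show ?thesis
    using le[of 0] le[of 1] le[of "-1"] assms card_UNIV' by auto
qed

section \<open>The Artin-Schreier map and the reduction to square counts\<close>

lemma cube_eq_self_iff: "(x :: 'a) ^ 3 = x \<longleftrightarrow> x \<in> {0, 1, -1}"
proof -
  have "x ^ 3 - x = x * (x - 1) * (x + 1)"
    by (simp add: algebra_simps power3_eq_cube)
  thus ?thesis
    by (auto simp: add_eq_0_iff2 simp del: power_eq_0_iff)
qed

text \<open>Cubing is additive, so x and y have the same image exactly when x - y is fixed by
  cubing, that is, lies in F_3.\<close>

lemma card_artin_schreier_fibre_self: "card {x :: 'a. x ^ 3 - x = y ^ 3 - y} = 3"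
proof -
  have "x ^ 3 - x = y ^ 3 - y \<longleftrightarrow> x - y \<in> {0, 1, -1}" for x
    unfolding cube_eq_self_iff [symmetric] using cube_add[of "x - y" y] by (auto simp: algebra_simps)
  hence "{x. x ^ 3 - x = y ^ 3 - y} = {y, y + 1, y - 1}"
    by (auto simp: diff_eq_eq add.commute)
  thus ?thesis
    using minus_one_neq_one by (auto simp: card_insert_if eq_diff_eq)
qed

text \<open>Additive Hilbert 90 by counting: the image has q/3 elements and lies in the kernel of
  the trace, which has the same size.\<close>

lemma card_artin_schreier_fibre:
  "card {x :: 'a. x ^ 3 - x = z} = (if trace_F3 d z = 0 then 3 else 0)"
proof -
  define f where "f = (\<lambda>x :: 'a. x ^ 3 - x)"
  have "card (UNIV :: 'a set) = 3 * card (range f)"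
    by (rule card_eq_mult_card_image) (auto simp: f_def card_artin_schreier_fibre_self)
  moreover have sub: "range f \<subseteq> {z. trace_F3 d z = 0}"
    by (auto simp: f_def trace_diff trace_cube)
  ultimately have img: "range f = {z. trace_F3 d z = 0}"
    using card_trace_eq[of 0] card_UNIV' by (intro card_subset_eq) auto
  show ?thesis
  proof (cases "trace_F3 d z = 0")
    case True
    then obtain y where "z = y ^ 3 - y"
      using img by (auto simp: f_def)
    thus ?thesis
      using True card_artin_schreier_fibre_self by simp
  next
    case False
    hence "{x. x ^ 3 - x = z} = {}"
      using sub by (auto simp: f_def)
    thus ?thesis
      using False by simp
  qed
qed

text \<open>This is N_c of the overview. It counts the roots \<open>y\<close>, not their
  squares.\<close>

definition square_count :: "'a \<Rightarrow> nat" where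
  "square_count c = card {y :: 'a. trace_F3 d (y ^ 2) = c}"

text \<open>For fixed y the possible x form the Artin-Schreier fibre over y^2 - b, which is nonempty
  iff y^2 and b have equal trace.\<close>

lemma card_curve_points:
  "card (curve_points (-1) (b :: 'a)) = 1 + 3 * square_count (trace_F3 d b)"
proof -
  define S where "S = (SIGMA y:UNIV. {x. x ^ 3 - x = y ^ 2 - b})"
  have "card S = (\<Sum>y\<in>UNIV. card {x. x ^ 3 - x = y ^ 2 - b})"
    unfolding S_def by (rule card_SigmaI) auto
  also have "\<dots> = (\<Sum>y\<in>UNIV. if trace_F3 d (y ^ 2) = trace_F3 d b then 3 else 0)"
    by (simp add: card_artin_schreier_fibre trace_diff)
  also have "\<dots> = 3 * square_count (trace_F3 d b)"
    by (simp add: square_count_def sum.If_cases)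
  finally have S: "card S = 3 * square_count (trace_F3 d b)" .
  have "curve_points (-1) b = insert Infinity ((\<lambda>(y, x). Affine x y) ` S)"
    by (auto simp: curve_points_def S_def algebra_simps image_iff)
  moreover have "card ((\<lambda>(y, x). Affine x y) ` S) = card S"
    by (rule card_image) (auto simp: inj_on_def)
  moreover have "finite S" by simp
  ultimately show ?thesis
    using S by (auto simp: card_insert_if)
qed

section \<open>The product over trace 1, and the quadratic character\<close>

text \<open>Vieta: \<open>trace_poly 1\<close> has constant coefficient -1 and splits into the
  factors X - a over the elements a of trace 1. Their number is odd, so the signs cancel.\<close>

lemma prod_trace_one: "\<Prod>{x :: 'a. trace_F3 d x = 1} = 1"
proof -
  define A where "A = {x :: 'a. trace_F3 d x = 1}"
  define q where "q = (\<Prod>a\<in>A. [:-a, 1:])"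
  have card: "card A = 3 ^ (d - 1)"
    using card_trace_eq[of 1] by (simp add: A_def)
  have deg: "degree q = 3 ^ (d - 1)"
    unfolding q_def by (subst degree_prod_sum_eq) (auto simp: card)
  have lead: "lead_coeff q = 1"
    unfolding q_def by (simp add: lead_coeff_prod)
  have "trace_poly 1 = q"
  \<comment> \<open>Both polynomials are monic of degree \<open>card A\<close> and vanish on
    \<open>A\<close>; their difference has too many roots for its degree.\<close>
  proof (rule poly_eqI_degree_lead_coeff[where n = "3 ^ (d - 1)" and A = A])
    show "poly (trace_poly 1) x = poly q x" if "x \<in> A" for x
      using that by (simp add: poly_trace_poly A_def q_def poly_prod)
  qed (use degree_trace_poly[of 1] lead_coeff_trace_poly[of 1] deg lead card in auto)
  hence "poly (trace_poly 1) 0 = poly q 0"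
    by simp
  hence "(\<Prod>a\<in>A. - a) = -1"
    by (simp add: poly_trace_poly trace_zero q_def poly_prod)
  moreover have "(\<Prod>a\<in>A. - a) = (-1) ^ card A * \<Prod>A"
    using prod.distrib[of "\<lambda>_. -1" "\<lambda>a. a" A] by simp
  ultimately show ?thesis
    unfolding A_def [symmetric] by (simp add: card)
qed

text \<open>Without 0, squaring is exactly two-to-one onto this set.\<close>

definition nonzero_squares :: "'a set" where
  "nonzero_squares = (\<lambda>y. y ^ 2) ` (- {0})"

text \<open>Euler's form of the quadratic character, with values in the field itself, so that
  multiplicativity is that of powers.\<close>

definition quadratic_char :: "'a \<Rightarrow> 'a" where
  "quadratic_char x = x ^ ((3 ^ d - 1) div 2)"

lemma card_square_fibre:
  assumes "z \<in> nonzero_squares"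
  shows "card {y. y ^ 2 = z} = 2"
proof -
  obtain y where y: "y \<noteq> 0" "z = y ^ 2"
    using assms by (auto simp: nonzero_squares_def)
  have "y \<noteq> - y"
  proof
    assume "y = - y"
    hence "2 * y = 0"
      by (metis add.right_inverse mult_2)
    thus False
      using y two_eq by simp
  qed
  moreover have "{x. x ^ 2 = z} = {y, - y}"
    using y by (auto simp: power2_eq_iff)
  ultimately show ?thesis by simp
qed

lemma half_order: "2 * ((3 ^ d - 1) div 2) = 3 ^ d - (1::nat)"
  by (simp add: dvd_mult_div_cancel)

lemma power_order: "(x :: 'a) \<noteq> 0 \<Longrightarrow> x ^ (3 ^ d - 1) = 1"
  using finite_field_power_card_eq_same[of x] card_UNIV
  by (simp add: power_eq_if[of x "3 ^ d"])

text \<open>Euler's criterion by counting: the (q-1)/2 nonzero squares are roots of X^((q-1)/2) - 1,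
  which has no room for further roots.\<close>

lemma nonzero_squares_eq: "nonzero_squares = {x. quadratic_char x = 1}"
proof -
  define n :: nat where "n = (3 ^ d - 1) div 2"
  have n: "2 * n = 3 ^ d - 1"
    using half_order by (simp add: n_def)
  \<comment> \<open>Positivity of \<open>n\<close> keeps the polynomial \<open>p\<close> below from
    being zero.\<close>
  have "3 ^ 1 \<le> (3 ^ d :: nat)"
    using degree_pos by (intro power_increasing) auto
  hence "n > 0" using n by simp
  have "card (- {0 :: 'a}) = 2 * card nonzero_squares"
    unfolding nonzero_squares_def
  proof (rule card_eq_mult_card_image)
    fix z :: 'a assume z: "z \<in> (\<lambda>y. y ^ 2) ` (- {0})"
    have "{x \<in> - {0}. x ^ 2 = z} = {x. x ^ 2 = z}"
      using z by auto
    thus "card {x \<in> - {0}. x ^ 2 = z} = 2"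
      using card_square_fibre[of z] z by (simp add: nonzero_squares_def)
  qed auto
  hence card: "card nonzero_squares = n"
    using n card_UNIV by (simp add: Compl_eq_Diff_UNIV)
  define p :: "'a poly" where "p = monom 1 n + [:-1:]"
  have "degree p = n"
    unfolding p_def using \<open>n > 0\<close> by (simp add: degree_add_eq_left degree_monom_eq)
  moreover from this have "p \<noteq> 0"
    using \<open>n > 0\<close> by auto
  ultimately have le: "card {x. quadratic_char x = 1} \<le> n"
    using card_poly_roots_bound[of p] by (simp add: p_def poly_monom quadratic_char_def n_def)
  have "nonzero_squares \<subseteq> {x. quadratic_char x = 1}"
    using power_order half_order
    by (auto simp: nonzero_squares_def quadratic_char_def power_mult [symmetric])
  thus ?thesis
    using le card by (intro card_seteq) auto
qed

lemma quadratic_char_cases: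
  assumes "x \<noteq> 0"
  shows "quadratic_char x = (if x \<in> nonzero_squares then 1 else -1)"
proof -
  have "quadratic_char x ^ 2 = 1"
    using power_order[OF assms] half_order
    by (simp add: quadratic_char_def power_mult [symmetric] mult.commute)
  thus ?thesis
    by (auto simp: nonzero_squares_eq power2_eq_1_iff)
qed

text \<open>Each nonsquare factor contributes -1. This turns the value of a product into the parity
  of a number of nonsquares.\<close>

lemma quadratic_char_prod:
  assumes "0 \<notin> A"
  shows "quadratic_char (\<Prod>A) = (-1) ^ card (A - nonzero_squares)"
proof -
  have "quadratic_char (\<Prod>A) = (\<Prod>x\<in>A. quadratic_char x)"
    by (simp add: quadratic_char_def prod_power_distrib)
  also have "\<dots> = (\<Prod>x\<in>A. if x \<in> nonzero_squares then 1 else -1)"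
    by (intro prod.cong refl quadratic_char_cases) (use assms in auto)
  also have "\<dots> = (-1) ^ card (A - nonzero_squares)"
    by (simp add: prod.If_cases Diff_eq)
  finally show ?thesis .
qed

section \<open>Parity of the square counts and the effect of negation\<close>

text \<open>A nonzero trace excludes y = 0, so every square that occurs has two roots.\<close>

lemma square_count_eq:
  assumes "c \<noteq> 0"
  shows "square_count c = 2 * card {s \<in> nonzero_squares. trace_F3 d s = c}"
proof -
  define A where "A = {y :: 'a. trace_F3 d (y ^ 2) = c}"
  have img: "(\<lambda>y. y ^ 2) ` A = {s \<in> nonzero_squares. trace_F3 d s = c}"
    using assms trace_zero by (auto simp: A_def nonzero_squares_def image_iff)
  have "card A = 2 * card ((\<lambda>y. y ^ 2) ` A)"
  proof (rule card_eq_mult_card_image)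
    fix z assume z: "z \<in> (\<lambda>y. y ^ 2) ` A"
    hence "{y \<in> A. y ^ 2 = z} = {y. y ^ 2 = z}"
      by (auto simp: A_def)
    thus "card {y \<in> A. y ^ 2 = z} = 2"
      using card_square_fibre[of z] z img by auto
  qed auto
  thus ?thesis
    by (simp add: square_count_def A_def [symmetric] img)
qed

lemma odd_card_squares_trace_one:
  "odd (card {s \<in> nonzero_squares. trace_F3 d s = 1})"
proof -
  define A where "A = {x :: 'a. trace_F3 d x = 1}"
  have "(-1 :: 'a) ^ card (A - nonzero_squares) = 1"
    using quadratic_char_prod[of A] prod_trace_one trace_zero
    by (simp add: A_def quadratic_char_def)
  hence "even (card (A - nonzero_squares))"
    using minus_one_power_eq_one_iff[OF minus_one_neq_one] by simp
  moreover have "card A = card (A - nonzero_squares) + card (A \<inter> nonzero_squares)"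
    using card_Diff_subset_Int[of A nonzero_squares] card_mono[of A "A \<inter> nonzero_squares"] by simp
  moreover have "odd (card A)"
    using card_trace_eq[of 1] by (simp add: A_def)
  moreover have "A \<inter> nonzero_squares = {s \<in> nonzero_squares. trace_F3 d s = 1}"
    by (auto simp: A_def)
  ultimately show ?thesis by simp
qed

lemma square_count_one_mod_4: "square_count 1 mod 4 = 2"
  using odd_card_squares_trace_one by (simp add: square_count_eq) presburger

text \<open>-1 is a square iff (q-1)/2 is even, i.e. iff 3^d is 1 modulo 4, i.e. iff
  \<open>d\<close> is even.\<close>

lemma minus_mem_nonzero_squares_iff:
  assumes "x \<noteq> 0"
  shows "- x \<in> nonzero_squares \<longleftrightarrow> (x \<in> nonzero_squares \<longleftrightarrow> even d)"
proof -
  have "even ((3 ^ d - 1) div 2 :: nat) \<longleftrightarrow> even d"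
    using three_power_mod_4[of d] by (auto split: if_splits) presburger+
  hence "quadratic_char (- x) = (if even d then 1 else -1) * quadratic_char x"
    unfolding quadratic_char_def by (simp add: power_minus[of x] minus_one_power_iff)
  thus ?thesis
    using assms quadratic_char_cases[of x] quadratic_char_cases[of "- x"] minus_one_neq_one
    by (auto split: if_splits)
qed

text \<open>Negation sends squares of trace -1 to elements of trace 1: to the squares if
  \<open>d\<close> is even, to the nonsquares if \<open>d\<close> is odd. The equivalence with
  \<open>even d\<close> covers both cases at once.\<close>

lemma card_squares_trace_minus_one:
  "card {s \<in> nonzero_squares. trace_F3 d s = -1} =
     card {s. (s \<in> nonzero_squares \<longleftrightarrow> even d) \<and> trace_F3 d s = 1}"
proof (rule bij_betw_same_card)
  have nonzero: "s \<noteq> 0" if "trace_F3 d s \<noteq> 0" for s :: 'a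
    using that trace_zero by auto
  show "bij_betw uminus {s \<in> nonzero_squares. trace_F3 d s = -1}
          {s. (s \<in> nonzero_squares \<longleftrightarrow> even d) \<and> trace_F3 d s = 1}"
    by (rule bij_betwI[where g = uminus])
       (use minus_mem_nonzero_squares_iff nonzero trace_minus in auto)
qed

lemma square_count_minus_one_even:
  assumes "even d"
  shows "square_count (-1) = square_count 1"
  using card_squares_trace_minus_one assms by (simp add: square_count_eq)

text \<open>Here negation pairs squares of trace -1 with nonsquares of trace 1, so both counts
  together see every element of trace 1, twice.\<close>

lemma square_count_minus_one_odd:
  assumes "odd d"
  shows "square_count (-1) + square_count 1 = 2 * 3 ^ (d - 1)"
proof -
  define A where "A = {x :: 'a. trace_F3 d x = 1}"
  have "card A = card (A - nonzero_squares) + card (A \<inter> nonzero_squares)"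
    using card_Diff_subset_Int[of A nonzero_squares] card_mono[of A "A \<inter> nonzero_squares"] by simp
  moreover have "A \<inter> nonzero_squares = {s \<in> nonzero_squares. trace_F3 d s = 1}"
    and "A - nonzero_squares = {s. s \<notin> nonzero_squares \<and> trace_F3 d s = 1}"
    by (auto simp: A_def)
  ultimately show ?thesis
    using card_squares_trace_minus_one assms card_trace_eq[of 1] by (simp add: square_count_eq A_def)
qed

section \<open>The sum and the sum of squares of the counts\<close>

lemma sum_square_count: "square_count 0 + square_count 1 + square_count (-1) = 3 ^ d"
proof -
  have "UNIV = {x :: 'a. trace_F3 d (x ^ 2) = 0} \<union> {x. trace_F3 d (x ^ 2) = 1} \<union> {x. trace_F3 d (x ^ 2) = -1}"
    using trace_F3_in_prime_field[OF card_UNIV] by auto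
  also have "card \<dots> = square_count 0 + square_count 1 + square_count (-1)"
    unfolding square_count_def
    by (subst card_Un_disjoint; (subst card_Un_disjoint)?) (use minus_one_neq_one in auto)
  finally show ?thesis
    using card_UNIV by simp
qed

text \<open>Both sides count pairs (x, y) whose squares have equal trace. With u = x - y and v = x +
  y the condition is Tr(uv) = 0: u = 0 admits all q values of v, any other u admits q/3.\<close>

lemma sum_square_count_squared:
  "square_count 0 ^ 2 + square_count 1 ^ 2 + square_count (-1) ^ 2
     = 3 ^ d + (3 ^ d - 1) * 3 ^ (d - 1)"
proof -
  define A where "A = (\<lambda>c. {y :: 'a. trace_F3 d (y ^ 2) = c})"
  define P where "P = {(x :: 'a, y). trace_F3 d (x ^ 2) = trace_F3 d (y ^ 2)}"
  have "P = A 0 \<times> A 0 \<union> A 1 \<times> A 1 \<union> A (-1) \<times> A (-1)"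
    using trace_F3_in_prime_field[OF card_UNIV] by (auto simp: P_def A_def set_eq_iff) metis+
  also have "card \<dots> = card (A 0 \<times> A 0) + card (A 1 \<times> A 1) + card (A (-1) \<times> A (-1))"
    by (subst card_Un_disjoint; (subst card_Un_disjoint)?) (use minus_one_neq_one in \<open>auto simp: A_def\<close>)
  finally have P: "card P = square_count 0 ^ 2 + square_count 1 ^ 2 + square_count (-1) ^ 2"
    by (simp add: card_cartesian_product power2_eq_square square_count_def A_def)
  define Q where "Q = (SIGMA u:UNIV. {v :: 'a. trace_F3 d (u * v) = 0})"
  \<comment> \<open>In characteristic 3 one half is -1, so the inverse substitution x = (u + v)/2, y
    = (v - u)/2 becomes x = - u - v, y = u - v.\<close>
  have neg: "- x - x = x" for x :: 'a
    using two_eq mult_2[of x] by (simp add: minus_diff_commute diff_eq_eq)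
  have inv: "- (x - y) - (x + y) = x" "(x - y) - (x + y) = y"
      "(- x - y) - (x - y) = x" "(- x - y) + (x - y) = y" for x y :: 'a
    using neg[of x] neg[of y] by (simp_all add: algebra_simps)
  have "bij_betw (\<lambda>(x, y). (x - y, x + y)) P Q"
  proof (rule bij_betwI[where g = "\<lambda>(u, v). (- u - v, u - v)"])
    show "(\<lambda>(x, y). (x - y, x + y)) \<in> P \<rightarrow> Q"
      by (auto simp: P_def Q_def trace_diff power2_eq_square algebra_simps)
    show "(\<lambda>(u, v). (- u - v, u - v)) \<in> Q \<rightarrow> P"
    proof (clarsimp simp: P_def Q_def)
      fix u v :: 'a assume "trace_F3 d (u * v) = 0"
      \<comment> \<open>The coefficient 4 is written as 3 + 1 so that \<open>three_eq_zero\<close>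
        can reduce it to 1.\<close>
      moreover have "(- u - v)\<^sup>2 = (u - v)\<^sup>2 + (3 + 1) * (u * v)"
        by (simp add: power2_eq_square algebra_simps)
      hence "(- u - v)\<^sup>2 = (u - v)\<^sup>2 + u * v"
        unfolding three_eq_zero by simp
      ultimately show "trace_F3 d ((- u - v)\<^sup>2) = trace_F3 d ((u - v)\<^sup>2)"
        by (simp add: trace_add)
    qed
  qed (simp_all only: split_paired_all prod.case inv)
  hence "card P = card Q"
    by (rule bij_betw_same_card)
  also have "card Q = (\<Sum>u\<in>UNIV. card {v :: 'a. trace_F3 d (u * v) = 0})"
    unfolding Q_def by (rule card_SigmaI) auto
  also have "\<dots> = card {v :: 'a. trace_F3 d (0 * v) = 0} + (\<Sum>u\<in>-{0}. card {v :: 'a. trace_F3 d (u * v) = 0})"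
    by (subst sum.remove[of _ 0]) (auto simp: Compl_eq_Diff_UNIV)
  also have "(\<Sum>u\<in>-{0}. card {v :: 'a. trace_F3 d (u * v) = 0}) = (\<Sum>u\<in>-{0 :: 'a}. 3 ^ (d - 1))"
  proof (rule sum.cong)
    fix u :: 'a assume "u \<in> - {0}"
    hence "bij_betw (\<lambda>v. u * v) {v. trace_F3 d (u * v) = 0} {v. trace_F3 d v = 0}"
      by (intro bij_betwI[where g = "\<lambda>v. v / u"]) auto
    from bij_betw_same_card[OF this] show "card {v. trace_F3 d (u * v) = 0} = 3 ^ (d - 1)"
      using card_trace_eq[of 0] by simp
  qed auto
  finally show ?thesis
    using P card_UNIV by (simp add: trace_zero Compl_eq_Diff_UNIV)
qed

section \<open>Solving for the square counts\<close>

text \<open>The linear relations leave only \<open>b\<close> unknown, and the sum of squares gives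
  (b - Q)^2 = Q. Modulo 4 this difference is 2 - 1 = 1, which fixes its sign.\<close>

lemma square_count_odd:
  assumes "d = 2 * k + 1"
  shows "int (square_count 0) = 9 ^ k"
    and "int (square_count 1) = 9 ^ k + (- 3) ^ k"
    and "int (square_count (-1)) = 9 ^ k - (- 3) ^ k"
proof -
  define a b c Q :: int where "a = square_count 0" and "b = square_count 1"
    and "c = square_count (-1)" and "Q = 9 ^ k"
  have pow: "3 ^ (d - 1) = Q" "3 ^ d = 3 * Q"
    using assms by (simp_all add: Q_def power_mult)
  have bc: "c + b = 2 * Q"
    using arg_cong[OF square_count_minus_one_odd, of int] assms pow by (simp add: b_def c_def)
  moreover have "a + b + c = 3 * Q"
    using arg_cong[OF sum_square_count, of int] pow by (simp add: a_def b_def c_def)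
  ultimately have a: "a = Q" by simp
  have "a\<^sup>2 + b\<^sup>2 + c\<^sup>2 = 3 * Q + (3 * Q - 1) * Q"
    using arg_cong[OF sum_square_count_squared, of int] pow
    by (simp add: a_def b_def c_def of_nat_diff)
  moreover have c: "c = 2 * Q - b"
    using bc by simp
  ultimately have "(b - Q)\<^sup>2 = Q"
    unfolding a c by (simp add: power2_eq_square algebra_simps)
  moreover have "(b - Q) mod 4 = 1"
  proof -
    have "b mod 4 = 2"
      using arg_cong[OF square_count_one_mod_4, of int] by (simp add: b_def zmod_int)
    moreover have "Q mod 4 = 1"
      by (simp add: Q_def flip: power_mod)
    ultimately show ?thesis by presburger
  qed
  ultimately have "b - Q = (- 3) ^ k"
    unfolding Q_def by (rule eq_minus_three_power)
  thus "int (square_count 0) = 9 ^ k" "int (square_count 1) = 9 ^ k + (- 3) ^ k"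
    "int (square_count (-1)) = 9 ^ k - (- 3) ^ k"
    using a c by (simp_all add: a_def b_def c_def Q_def)
qed

text \<open>Now the counts at 1 and -1 agree, and the deviation from the mean 3Q is taken as 3Q - b,
  in this order, because it is then 3 - 2 = 1 modulo 4.\<close>

lemma square_count_even:
  assumes "d = 2 * k + 2"
  shows "int (square_count 0) = 3 * 9 ^ k + 2 * (- 3) ^ k"
    and "int (square_count 1) = 3 * 9 ^ k - (- 3) ^ k"
    and "int (square_count (-1)) = 3 * 9 ^ k - (- 3) ^ k"
proof -
  define a b Q :: int where "a = square_count 0" and "b = square_count 1" and "Q = 9 ^ k"
  have pow: "3 ^ (d - 1) = 3 * Q" "3 ^ d = 9 * Q"
    using assms by (simp_all add: Q_def power_mult)
  have c: "square_count (-1) = square_count 1"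
    using square_count_minus_one_even assms by simp
  have a: "a = 9 * Q - 2 * b"
    using arg_cong[OF sum_square_count, of int] pow c by (simp add: a_def b_def)
  have "a\<^sup>2 + b\<^sup>2 + b\<^sup>2 = 9 * Q + (9 * Q - 1) * (3 * Q)"
    using arg_cong[OF sum_square_count_squared, of int] pow c
    by (simp add: a_def b_def of_nat_diff)
  hence "(3 * Q - b)\<^sup>2 = Q"
    unfolding a by (simp add: power2_eq_square algebra_simps)
  moreover have "(3 * Q - b) mod 4 = 1"
  proof -
    have "b mod 4 = 2"
      using arg_cong[OF square_count_one_mod_4, of int] by (simp add: b_def zmod_int)
    moreover have "Q mod 4 = 1"
      by (simp add: Q_def flip: power_mod)
    ultimately show ?thesis by presburger
  qed
  ultimately have "3 * Q - b = (- 3) ^ k"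
    unfolding Q_def by (rule eq_minus_three_power)
  thus "int (square_count 0) = 3 * 9 ^ k + 2 * (- 3) ^ k"
    "int (square_count 1) = 3 * 9 ^ k - (- 3) ^ k"
    "int (square_count (-1)) = 3 * 9 ^ k - (- 3) ^ k"
    using a c by (simp_all add: a_def b_def Q_def)
qed

end

theorem proposition3p2:
  fixes b :: "'a :: finite_field" and q d :: nat
  assumes "d \<ge> 1" and "q = 3 ^ d" and "CARD('a) = q"
  shows "(odd d \<longrightarrow>
            (trace_F3 d b = 0 \<longrightarrow>
               real (card (curve_points (-1) b)) = real q + 1) \<and>
            (trace_F3 d b = 1 \<longrightarrow>
               real (card (curve_points (-1) b))
                 = real q + 1 + (-1) ^ ((d - 1) div 2) * sqrt (3 * real q)) \<and>
            (trace_F3 d b = -1 \<longrightarrow>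
               real (card (curve_points (-1) b))
                 = real q + 1 - (-1) ^ ((d - 1) div 2) * sqrt (3 * real q))) \<and>
         (even d \<longrightarrow>
            (trace_F3 d b = 0 \<longrightarrow>
               real (card (curve_points (-1) b))
                 = real q + 1 - (-1) ^ (d div 2) * (2 * sqrt (real q))) \<and>
            (trace_F3 d b = 1 \<or> trace_F3 d b = -1 \<longrightarrow>
               real (card (curve_points (-1) b))
                 = real q + 1 + (-1) ^ (d div 2) * sqrt (real q)))"
proof -
  have card: "CARD('a) = 3 ^ d"
    using assms by simp
  have E: "real (card (curve_points (-1) b)) = 1 + 3 * real (square_count d (trace_F3 d b))"
    using card_curve_points[OF card] by simp
  \<comment> \<open>One root serves both cases: \<open>9 * 9 ^ k\<close> is 3q for odd
    \<open>d = 2 * k + 1\<close> and q for even \<open>d = 2 * k + 2\<close>.\<close>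
  have root: "sqrt (9 * 9 ^ k) = 3 * 3 ^ k" for k :: nat
    by (rule real_sqrt_unique) (simp_all add: power2_eq_square flip: power_mult_distrib)
  have sign: "(- 3 :: real) ^ k = (-1) ^ k * 3 ^ k" for k :: nat
    by (simp flip: power_mult_distrib)
  show ?thesis
  proof (cases "even d")
    case False
    then obtain k where d: "d = 2 * k + 1"
      by (auto elim: oddE)
    have q: "real q = 3 * 9 ^ k"
      using assms d by (simp add: power_mult)
    show ?thesis
      using False square_count_odd[OF card d, THEN arg_cong[of _ _ real_of_int]] root[of k]
      unfolding E q by (auto simp: d sign)
  next
    case True
    \<comment> \<open>Here k = d/2 - 1, so (-1)^k is the opposite of (-1)^(d/2); this accounts for
      the signs in the even case.\<close>
    with assms(1) obtain k where d: "d = 2 * k + 2"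
      using that[of "d div 2 - 1"] by fastforce
    have q: "real q = 9 * 9 ^ k"
      using assms d by (simp add: power_mult)
    show ?thesis
      using True square_count_even[OF card d, THEN arg_cong[of _ _ real_of_int]] root[of k]
      unfolding E q by (auto simp: d sign)
  qed
qed

end
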